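(* For $n \ge 3$, let $W_n$ be the wheel graph on $n+1$ vertices, and let $w$ be the central vertex of $W_n$. Then, for any $v\in V(W_n)$, (a) $\mathrm{cdim}(W_3)=3=\mathrm{cdim}_{W_3}(v)$; (b) for $n \in \{4,5\}$, $\mathrm{cdim}(W_n)=2=\mathrm{cdim}_{W_n}(v)$ for $v\neq w$, and $\mathrm{cdim}_{W_n}(w)=3$; (c) for $n \ge 6$, $\mathrm{cdim}(W_n)=\lfloor\frac{2n+2}{5}\rfloor+1=\mathrm{cdim}_{W_n}(v)$.
   Context: The wheel graph $W_n=C_n+K_1$ is obtained from the cycle $C_n$ by adding a new vertex $w$ (the central vertex) adjacent to every vertex of $C_n$. A set $S\subseteq V(G)$ is a resolving set of a connected graph $G$ if for every pair of distinct vertices $x,y$ of $G$ there is $z\in S$ with $d(x,z)\ne d(y,z)$ ($d$ is the shortest-path distance); it is a connected resolving set if moreover the induced subgraph $G[S]$ is connected. $\mathrm{cdim}(G)$ is the minimum cardinality of a connected resolving set of $G$, and $\mathrm{cdim}_G(v)$ is the minimum cardinality of a connected resolving set containing $v$. *)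

theory Defs
  imports Complex_Main "Graph_Theory.Graph_Theory"
begin

text \<open>
  A simple graph is a finite symmetric loop-free digraph (locale \<^locale>\<open>graph\<close>, or
  \<^locale>\<open>pair_graph\<close> when arcs are pairs of vertices). The definitions up to \<open>cdim_at\<close> are meant
  for finite connected graphs. Giving every arc weight 1, \<open>graph_dist\<close> is the length of a shortest
  path.
\<close>

definition graph_dist :: "('a, 'b) pre_digraph \<Rightarrow> 'a \<Rightarrow> 'a \<Rightarrow> ereal" where
  "graph_dist G u v = wf_digraph.\<mu> G (\<lambda>_. 1) u v"

definition resolving_set :: "('a, 'b) pre_digraph \<Rightarrow> 'a set \<Rightarrow> bool" where
  "resolving_set G S \<longleftrightarrow> S \<subseteq> verts G \<and>
     (\<forall>x\<in>verts G. \<forall>y\<in>verts G. x \<noteq> y \<longrightarrow> (\<exists>z\<in>S. graph_dist G x z \<noteq> graph_dist G y z))"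

text \<open>The library constant is qualified because of the homonymous topological notion.\<close>

definition connected_resolving_set :: "('a, 'b) pre_digraph \<Rightarrow> 'a set \<Rightarrow> bool" where
  "connected_resolving_set G S \<longleftrightarrow>
     resolving_set G S \<and> Digraph_Component.connected (G \<restriction> S)"

text \<open>
  In a finite connected graph the whole vertex set is a connected resolving set, so both minima
  below are attained.
\<close>

definition cdim :: "('a, 'b) pre_digraph \<Rightarrow> nat" where
  "cdim G = (LEAST k. \<exists>S. connected_resolving_set G S \<and> card S = k)"

definition cdim_at :: "('a, 'b) pre_digraph \<Rightarrow> 'a \<Rightarrow> nat" where
  "cdim_at G v = (LEAST k. \<exists>S. connected_resolving_set G S \<and> v \<in> S \<and> card S = k)"

text \<open>A simple graph only for \<open>n \<ge> 3\<close>: there is a loop for \<open>n = 1\<close>.\<close>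

definition cycle_graph :: "nat \<Rightarrow> nat pair_pre_digraph" where
  "cycle_graph n = \<lparr> pverts = {0..<n},
     parcs = {(i, j). i < n \<and> j < n \<and> (j = Suc i mod n \<or> i = Suc j mod n)} \<rparr>"

text \<open>The join \<open>G + K\<^sub>1\<close>; the added vertex is \<^term>\<open>None\<close>.\<close>

definition join_K1 :: "'a pair_pre_digraph \<Rightarrow> 'a option pair_pre_digraph" where
  "join_K1 G = \<lparr> pverts = insert None (Some ` pverts G),
     parcs = {(Some x, Some y) | x y. (x, y) \<in> parcs G}
       \<union> {(None, Some x) | x. x \<in> pverts G} \<union> {(Some x, None) | x. x \<in> pverts G} \<rparr>"

definition wheel_graph :: "nat \<Rightarrow> nat option pair_pre_digraph" where
  "wheel_graph n = join_K1 (cycle_graph n)"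

abbreviation hub :: "nat option" where
  "hub \<equiv> None"

lemma pair_graph_wheel_graph:
  assumes "n \<ge> 3"
  shows "pair_graph (wheel_graph n)"
proof -
  have "parcs (wheel_graph n) \<subseteq> pverts (wheel_graph n) \<times> pverts (wheel_graph n)"
    by (auto simp: wheel_graph_def join_K1_def cycle_graph_def)
  moreover have fin: "finite (pverts (wheel_graph n))"
    by (simp add: wheel_graph_def join_K1_def cycle_graph_def)
  ultimately have "finite (parcs (wheel_graph n))"
    by (meson finite_SigmaI finite_subset)
  moreover have "Suc i mod n \<noteq> i" "i \<noteq> Suc i mod n" if "i < n" for i
    using assms that by (cases "Suc i = n"; auto)+
  ultimately show ?thesis
    using fin
    by unfold_locales
      (auto simp: wheel_graph_def join_K1_def cycle_graph_def symmetric_def sym_def)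
qed

end

theory Submission
  imports Defs
begin

text \<open>
  In a wheel all distances are at most 2, so a set resolves it if and only if any two vertices
  outside the set are separated by adjacency to it (\<open>resolving_set_join_K1_iff\<close>). If the hub belongs
  to the set, connectedness is automatic, the hub separates nothing, and the question is how small a
  set \<open>R\<close> of rim vertices can be if the other rim vertices have pairwise distinct codes, where the
  code of a vertex is its set of neighbours in \<open>R\<close>: a locating set of the cycle.

  Counting adjacencies between \<open>R\<close> and its complement gives \<open>2 * n \<le> 5 * card R + 2\<close>, because at most
  one code is empty and at most \<open>card R\<close> codes are singletons (\<open>locating_set_card_bound\<close>). For
  \<open>n \<ge> 6\<close> this is sharp: a pattern of period 5, whose gaps have lengths 1 and 2 alternately, with one
  irregularity where the cycle closes up, attains \<open>(2 * n + 2) div 5\<close>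
  (\<open>ex_optimal_locating_set_cycle_graph\<close>). Rotating the pattern puts any rim vertex into \<open>R\<close>, so
  prescribing a vertex costs nothing.

  If the hub is not in the set, connectedness forces the set to be an arc of the rim that misses at
  most three vertices (\<open>connected_locating_set_cycle_graph_card_bound\<close>). For \<open>n \<ge> 6\<close> such an arc has
  at least \<open>n - 3 \<ge> (2 * n + 2) div 5 + 1\<close> vertices and improves nothing, whereas for \<open>n = 4\<close> and
  \<open>n = 5\<close> an edge of the rim suffices, which beats every set through the hub. Finally \<open>W\<^sub>3\<close> is
  complete, so a resolving set omits at most one vertex.
\<close>

section \<open>Resolving sets in a join with a single vertex\<close>

text \<open>
  The weakening of Slater's locating-dominating sets in which one vertex may have no neighbour in
  \<open>R\<close>. It is what remains of resolvability when all distances are at most 2.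
\<close>

definition locating_set :: "'a pair_pre_digraph \<Rightarrow> 'a set \<Rightarrow> bool" where
  "locating_set G R \<longleftrightarrow> R \<subseteq> pverts G \<and>
     (\<forall>x\<in>pverts G - R. \<forall>y\<in>pverts G - R. x \<noteq> y \<longrightarrow>
        (\<exists>z\<in>R. ((x, z) \<in> parcs G) \<noteq> ((y, z) \<in> parcs G)))"

lemma locating_setE:
  assumes "locating_set G R" "x \<in> pverts G" "x \<notin> R" "y \<in> pverts G" "y \<notin> R" "x \<noteq> y"
  obtains z where "z \<in> R" "((x, z) \<in> parcs G) \<noteq> ((y, z) \<in> parcs G)"
  using assms unfolding locating_set_def by blast

lemma pverts_join_K1 [simp]: "pverts (join_K1 G) = insert None (Some ` pverts G)"
  by (simp add: join_K1_def)

lemma parcs_join_K1 [simp]: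
  "(Some x, Some y) \<in> parcs (join_K1 G) \<longleftrightarrow> (x, y) \<in> parcs G"
  "(None, Some x) \<in> parcs (join_K1 G) \<longleftrightarrow> x \<in> pverts G"
  "(Some x, None) \<in> parcs (join_K1 G) \<longleftrightarrow> x \<in> pverts G"
  "(None, None) \<notin> parcs (join_K1 G)"
  by (auto simp: join_K1_def)

lemma pair_bidirected_digraph_join_K1:
  assumes "pair_bidirected_digraph G"
  shows "pair_bidirected_digraph (join_K1 G)"
proof -
  interpret pair_bidirected_digraph G by (rule assms)
  show ?thesis
  proof
    show "symmetric (with_proj (join_K1 G))"
      using pair_sym_arcs by (auto simp: symmetric_def sym_def join_K1_def)
  next
    fix e assume "e \<in> parcs (join_K1 G)"
    then show "fst e \<in> pverts (join_K1 G)" "snd e \<in> pverts (join_K1 G)" "fst e \<noteq> snd e"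
      using pair_no_loops by (auto simp: join_K1_def dest: wellformed')
  qed
qed

text \<open>
  Two vertices of \<open>G\<close> that are not adjacent are joined by the walk through the apex, so distances
  in a join with \<open>K\<^sub>1\<close> record adjacency and nothing more.
\<close>

lemma graph_dist_join_K1:
  assumes G: "pair_bidirected_digraph G"
    and x: "x \<in> pverts (join_K1 G)" and y: "y \<in> pverts (join_K1 G)"
  shows "graph_dist (with_proj (join_K1 G)) x y =
    (if x = y then 0 else if (x, y) \<in> parcs (join_K1 G) then 1 else 2)"
proof -
  interpret H: pair_bidirected_digraph "join_K1 G"
    by (rule pair_bidirected_digraph_join_K1[OF G])
  define d :: ereal where "d = (if x = y then 0 else if (x, y) \<in> parcs (join_K1 G) then 1 else 2)"
  have cost: "H.awalk_cost (\<lambda>_. 1) p = real (length p)" for p :: "('a option \<times> 'a option) list"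
    by (induction p) auto
  have "H.\<mu> (\<lambda>_. 1) x y = (INF p\<in>{p. H.awalk x p y}. ereal (real (length p)))"
    by (simp add: H.\<mu>_def cost)
  also have "\<dots> = d"
  proof (rule antisym)
    have "\<exists>p. H.awalk x p y \<and> ereal (real (length p)) = d"
    proof -
      consider "x = y" | "x \<noteq> y" "(x, y) \<in> parcs (join_K1 G)"
        | a b where "x = Some a" "y = Some b" "x \<noteq> y" "(x, y) \<notin> parcs (join_K1 G)"
          "a \<in> pverts G" "b \<in> pverts G"
        using x y by (cases x; cases y) auto
      then show ?thesis
      proof cases
        case 1
        then show ?thesis using x by (intro exI[of _ "[]"]) (simp add: d_def H.awalk_Nil_iff zero_ereal_def)
      next
        case 2
        then show ?thesis using x y
          by (intro exI[of _ "[(x, y)]"]) (simp add: d_def H.awalk_simps one_ereal_def)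
      next
        case 3
        then show ?thesis
          by (intro exI[of _ "[(x, None), (None, y)]"]) (auto simp: d_def H.awalk_simps)
      qed
    qed
    then obtain p where "H.awalk x p y" "ereal (real (length p)) = d"
      by (elim exE conjE)
    then show "(INF p\<in>{p. H.awalk x p y}. ereal (real (length p))) \<le> d"
      by (intro INF_lower2[of p]) auto
  next
    show "d \<le> (INF p\<in>{p. H.awalk x p y}. ereal (real (length p)))"
    proof (rule INF_greatest, clarify)
      fix p assume p: "H.awalk x p y"
      consider "length p = 0" | "length p = 1" | "2 \<le> length p" by linarith
      then show "d \<le> ereal (real (length p))"
      proof cases
        case 1
        then have "x = y" using p by (simp add: H.awalk_Nil_iff)
        then show ?thesis by (simp add: d_def)
      next
        case 2
        then have "(x, y) \<in> parcs (join_K1 G)"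
          using p by (auto simp: length_Suc_conv H.awalk_simps)
        then show ?thesis using 2 by (simp add: d_def one_ereal_def)
      next
        case 3
        have "d \<le> ereal 2" by (simp add: d_def)
        also have "\<dots> \<le> ereal (real (length p))" using 3 by simp
        finally show ?thesis .
      qed
    qed
  qed
  finally show ?thesis by (simp only: graph_dist_def d_def)
qed

text \<open>
  A vertex of \<open>S\<close> is told apart from every other vertex by itself, so only pairs outside \<open>S\<close>
  matter, and for these the distances to \<open>S\<close> are 1 or 2 according to adjacency.
\<close>

lemma resolving_set_join_K1_iff:
  assumes G: "pair_bidirected_digraph G"
  shows "resolving_set (with_proj (join_K1 G)) S \<longleftrightarrow> locating_set (join_K1 G) S"
proof -
  let ?V = "pverts (join_K1 G)" and ?A = "parcs (join_K1 G)"
  let ?dist = "graph_dist (with_proj (join_K1 G))"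
  have dist_neq_iff: "?dist x z \<noteq> ?dist y z \<longleftrightarrow> ((x, z) \<in> ?A) \<noteq> ((y, z) \<in> ?A)"
    if "x \<in> ?V" "y \<in> ?V" "z \<in> ?V" "x \<noteq> z" "y \<noteq> z" for x y z
    unfolding graph_dist_join_K1[OF G that(1,3)] graph_dist_join_K1[OF G that(2,3)]
    using that(4,5) by simp
  have dist_self: "?dist x x \<noteq> ?dist y x" "?dist y x \<noteq> ?dist x x"
    if "x \<in> ?V" "y \<in> ?V" "x \<noteq> y" for x y
    unfolding graph_dist_join_K1[OF G that(1,1)] graph_dist_join_K1[OF G that(2,1)]
    using that(3) by auto
  have resolves_iff: "(\<exists>z\<in>S. ?dist x z \<noteq> ?dist y z) \<longleftrightarrow>
      x \<in> S \<or> y \<in> S \<or> (\<exists>z\<in>S. ((x, z) \<in> ?A) \<noteq> ((y, z) \<in> ?A))"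
    if "S \<subseteq> ?V" "x \<in> ?V" "y \<in> ?V" "x \<noteq> y" for x y
  proof (cases "x \<in> S \<or> y \<in> S")
    case True
    then show ?thesis using dist_self[of x y] dist_self[of y x] that by blast
  next
    case False
    then have "?dist x z \<noteq> ?dist y z \<longleftrightarrow> ((x, z) \<in> ?A) \<noteq> ((y, z) \<in> ?A)" if "z \<in> S" for z
      using that \<open>S \<subseteq> ?V\<close> \<open>x \<in> ?V\<close> \<open>y \<in> ?V\<close> by (intro dist_neq_iff) blast+
    with False show ?thesis by blast
  qed
  show ?thesis
    unfolding resolving_set_def locating_set_def with_proj_simps
  proof (rule conj_cong[OF refl])
    assume "S \<subseteq> ?V"
    note iff = resolves_iff[OF this]
    show "(\<forall>x\<in>?V. \<forall>y\<in>?V. x \<noteq> y \<longrightarrow> (\<exists>z\<in>S. ?dist x z \<noteq> ?dist y z)) \<longleftrightarrow>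
      (\<forall>x\<in>?V - S. \<forall>y\<in>?V - S. x \<noteq> y \<longrightarrow>
        (\<exists>z\<in>S. ((x, z) \<in> ?A) \<noteq> ((y, z) \<in> ?A)))"
      (is "?L \<longleftrightarrow> ?R")
    proof (intro iffI ballI impI)
      fix x y assume "?L" "x \<in> ?V - S" "y \<in> ?V - S" "x \<noteq> y"
      then show "\<exists>z\<in>S. ((x, z) \<in> ?A) \<noteq> ((y, z) \<in> ?A)"
        using iff[of x y] by (metis DiffD1 DiffD2)
    next
      fix x y assume "?R" "x \<in> ?V" "y \<in> ?V" "x \<noteq> y"
      then show "\<exists>z\<in>S. ?dist x z \<noteq> ?dist y z"
        using iff[of x y] by (metis DiffI)
    qed
  qed
qed

text \<open>
  The apex is adjacent to all of \<open>G\<close>, hence separates no two of its vertices; and once it lies in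
  the set, it need not be separated from anything.
\<close>

lemma locating_set_join_K1_insert_iff:
  "locating_set (join_K1 G) (insert None (Some ` R)) \<longleftrightarrow> locating_set G R"
proof -
  let ?S = "insert None (Some ` R)" and ?W = "Some ` (pverts G - R)"
  have diff: "pverts (join_K1 G) - ?S = ?W" by auto
  have sub: "?S \<subseteq> pverts (join_K1 G) \<longleftrightarrow> R \<subseteq> pverts G" by auto
  have "locating_set (join_K1 G) ?S \<longleftrightarrow> R \<subseteq> pverts G \<and>
      (\<forall>x\<in>?W. \<forall>y\<in>?W. x \<noteq> y \<longrightarrow>
        (\<exists>z\<in>?S. ((x, z) \<in> parcs (join_K1 G)) \<noteq> ((y, z) \<in> parcs (join_K1 G))))"
    unfolding locating_set_def diff sub by (rule refl)
  also have "\<dots> \<longleftrightarrow> locating_set G R"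
    unfolding locating_set_def ball_simps bex_simps parcs_join_K1 option.inject by simp
  finally show ?thesis .
qed

text \<open>
  When the apex is outside the set, it sees every element of \<open>R\<close>, so it is separated from exactly
  those vertices that miss some element of \<open>R\<close>.
\<close>

lemma locating_set_join_K1_image_iff:
  "locating_set (join_K1 G) (Some ` R) \<longleftrightarrow>
     locating_set G R \<and> (\<forall>x\<in>pverts G - R. \<exists>z\<in>R. (x, z) \<notin> parcs G)"
proof (cases "R \<subseteq> pverts G")
  case sub: True
  let ?W = "insert None (Some ` (pverts G - R))"
  define sep where "sep x y \<longleftrightarrow>
    (\<exists>z\<in>R. ((x, Some z) \<in> parcs (join_K1 G)) \<noteq> ((y, Some z) \<in> parcs (join_K1 G)))" for x y
  have sep_Some: "sep (Some x) (Some y) \<longleftrightarrow>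
      (\<exists>z\<in>R. ((x, z) \<in> parcs G) \<noteq> ((y, z) \<in> parcs G))" for x y
    by (simp add: sep_def)
  have sep_None: "sep None (Some x) \<longleftrightarrow> (\<exists>z\<in>R. (x, z) \<notin> parcs G)" for x
    unfolding sep_def parcs_join_K1 using sub by blast
  have sep_commute: "sep x y \<longleftrightarrow> sep y x" for x y
    unfolding sep_def by blast
  have diff: "pverts (join_K1 G) - Some ` R = ?W" by auto
  have sub': "Some ` R \<subseteq> pverts (join_K1 G)" using sub by auto
  have "locating_set (join_K1 G) (Some ` R) \<longleftrightarrow>
      (\<forall>x\<in>?W. \<forall>y\<in>?W. x \<noteq> y \<longrightarrow> sep x y)"
    unfolding locating_set_def diff sep_def using sub' by simp
  also have "\<dots> \<longleftrightarrow> (\<forall>x\<in>pverts G - R. \<forall>y\<in>pverts G - R. x \<noteq> y \<longrightarrow> sep (Some x) (Some y)) \<and>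
      (\<forall>x\<in>pverts G - R. sep None (Some x))"
    using sep_commute by auto
  also have "\<dots> \<longleftrightarrow>
      locating_set G R \<and> (\<forall>x\<in>pverts G - R. \<exists>z\<in>R. (x, z) \<notin> parcs G)"
    unfolding locating_set_def sep_Some sep_None using sub by simp
  finally show ?thesis .
next
  case False
  then show ?thesis by (auto simp: locating_set_def)
qed

section \<open>Connected induced subgraphs\<close>

text \<open>
  A path from inside \<open>X\<close> to the rest of \<open>S\<close> has a first arc that leaves \<open>X\<close>. Lower bounds use
  connectedness only in this form.
\<close>

lemma connected_imp_crossing_arc:
  assumes conn: "Digraph_Component.connected (with_proj H \<restriction> S)"
    and X: "X \<subseteq> S" "X \<noteq> {}" "X \<noteq> S"
  obtains x y where "x \<in> X" "y \<in> S - X" "(x, y) \<in> parcs H \<or> (y, x) \<in> parcs H"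
proof (rule ccontr)
  assume contra: "\<not> thesis"
  let ?K = "with_proj (mk_symmetric (with_proj H \<restriction> S))"
  obtain x y where xy: "x \<in> X" "y \<in> S" "y \<notin> X" using X by blast
  have "x \<rightarrow>\<^sup>*\<^bsub>?K\<^esub> y"
    using conn xy X by (auto simp: connected_def strongly_connected_def mk_symmetric_def)
  then have "(x, y) \<in> (parcs (mk_symmetric (with_proj H \<restriction> S)))\<^sup>*"
    unfolding reachable_def by (auto intro: rtrancl_on_rtranclI)
  then have "y \<in> X"
  proof (induction rule: rtrancl_induct)
    case base show ?case by (rule xy)
  next
    case (step u w)
    then have "w \<in> S" "(u, w) \<in> parcs H \<or> (w, u) \<in> parcs H"
      by (auto simp: mk_symmetric_def induce_subgraph_def)
    then show ?case using step contra that by blast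
  qed
  then show False using xy by simp
qed

lemma connected_induced_join_K1:
  assumes S: "S \<subseteq> pverts (join_K1 G)" "None \<in> S"
  shows "Digraph_Component.connected (with_proj (join_K1 G) \<restriction> S)"
proof -
  let ?M = "mk_symmetric (with_proj (join_K1 G) \<restriction> S)"
  have arc: "(Some x, None) \<in> parcs ?M" "(None, Some x) \<in> parcs ?M"
    if "Some x \<in> S" for x
  proof -
    have "x \<in> pverts G" using that S by auto
    then have "(None, Some x) \<in> {e \<in> parcs (join_K1 G). fst e \<in> S \<and> snd e \<in> S}"
      using that S by simp
    then show "(Some x, None) \<in> parcs ?M" "(None, Some x) \<in> parcs ?M"
      by (force simp: mk_symmetric_def induce_subgraph_def)+
  qed
  have pv: "pverts ?M = S" by (simp add: mk_symmetric_def)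
  interpret M: pair_wf_digraph ?M
    by unfold_locales (auto simp: mk_symmetric_def induce_subgraph_def)
  have "u \<rightarrow>\<^sup>*\<^bsub>with_proj ?M\<^esub> None" "None \<rightarrow>\<^sup>*\<^bsub>with_proj ?M\<^esub> u" if "u \<in> S" for u
    using arc[of "the u"] that S pv by (cases u; force intro: M.reachable_adjI)+
  then have "u \<rightarrow>\<^sup>*\<^bsub>with_proj ?M\<^esub> v" if "u \<in> S" "v \<in> S" for u v
    using that by (meson M.reachable_trans)
  then show ?thesis
    using S by (auto simp: connected_def strongly_connected_def pv)
qed

lemma connected_induced_adjacent_pair:
  assumes "(a, b) \<in> parcs H"
  shows "Digraph_Component.connected (with_proj H \<restriction> {a, b})"
proof -
  let ?M = "mk_symmetric (with_proj H \<restriction> {a, b})"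
  have pv: "pverts ?M = {a, b}" by (simp add: mk_symmetric_def)
  interpret M: pair_wf_digraph ?M
    by unfold_locales (auto simp: mk_symmetric_def induce_subgraph_def)
  have "(a, b) \<in> parcs ?M" "(b, a) \<in> parcs ?M"
    using assms by (force simp: mk_symmetric_def induce_subgraph_def)+
  then have "a \<rightarrow>\<^sup>*\<^bsub>with_proj ?M\<^esub> b" "b \<rightarrow>\<^sup>*\<^bsub>with_proj ?M\<^esub> a"
    by (auto intro: M.reachable_adjI)
  then show ?thesis
    using pv by (auto simp: connected_def strongly_connected_def)
qed

section \<open>Size and symmetry of locating sets\<close>

text \<open>
  Let each vertex \<open>x\<close> outside \<open>R\<close> have the code \<open>N x\<close>, its set of neighbours in \<open>R\<close>. Codes are
  distinct, so at most one is empty and at most \<open>card R\<close> are singletons; all others have at least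
  two elements. The codes have total size at most \<open>d * card R\<close>, since each element of \<open>R\<close> has at
  most \<open>d\<close> neighbours. Comparing the two estimates of the total size gives the bound.
\<close>

lemma locating_set_card_bound:
  assumes loc: "locating_set G R" and fin: "finite (pverts G)"
    and deg: "\<And>z. z \<in> R \<Longrightarrow> card {x \<in> pverts G. (x, z) \<in> parcs G} \<le> d"
  shows "2 * card (pverts G) \<le> (d + 3) * card R + 2"
proof -
  define U where "U = pverts G - R"
  define N where "N x = {z \<in> R. (x, z) \<in> parcs G}" for x
  define U0 where "U0 = {x \<in> U. N x = {}}"
  define U1 where "U1 = {x \<in> U. card (N x) = 1}"
  have RV: "R \<subseteq> pverts G" using loc by (simp add: locating_set_def)
  then have finR: "finite R" using fin finite_subset by blast
  have finU: "finite U" by (simp add: U_def fin)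
  have finN: "finite (N x)" for x using finR by (simp add: N_def)
  have inj: "x = y" if "x \<in> U" "y \<in> U" "N x = N y" for x y
    using loc that unfolding locating_set_def U_def N_def by blast
  have c0: "card U0 \<le> 1"
    using finU inj by (auto simp: U0_def card_le_Suc0_iff_eq)
  have c1: "card U1 \<le> card R"
  proof (rule card_inj_on_le)
    show "inj_on (\<lambda>x. the_elem (N x)) U1"
      using inj by (auto simp: U1_def inj_on_def card_1_singleton_iff)
    show "(\<lambda>x. the_elem (N x)) ` U1 \<subseteq> R"
      by (auto simp: U1_def card_1_singleton_iff) (auto simp: N_def)
  qed (rule finR)
  have "(\<Sum>x\<in>U. card (N x)) = (\<Sum>z\<in>R. card {x \<in> U. (x, z) \<in> parcs G})"
    unfolding N_def using finU finR by (rule sum_multicount_gen) auto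
  also have "\<dots> \<le> (\<Sum>z\<in>R. d)"
    by (intro sum_mono order.trans[OF card_mono deg]) (auto simp: U_def fin)
  finally have edges: "(\<Sum>x\<in>U. card (N x)) \<le> d * card R"
    by (simp add: mult.commute)
  have "2 * card U = (\<Sum>x\<in>U. 2)" by simp
  also have "\<dots> \<le> (\<Sum>x\<in>U. card (N x) + of_bool (x \<in> U1) + 2 * of_bool (x \<in> U0))"
  proof (rule sum_mono)
    fix x assume x: "x \<in> U"
    consider "card (N x) = 0" | "card (N x) = 1" | "2 \<le> card (N x)" by linarith
    then show "2 \<le> card (N x) + of_bool (x \<in> U1) + 2 * of_bool (x \<in> U0)"
      using x finN by cases (auto simp: U0_def U1_def)
  qed
  also have "\<dots> = (\<Sum>x\<in>U. card (N x)) + card U1 + 2 * card U0"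
    using finU by (simp add: sum.distrib U0_def U1_def flip: sum_distrib_left)
      (simp add: Int_def conj_commute)
  finally have "2 * card U \<le> d * card R + card R + 2"
    using edges c0 c1 by linarith
  moreover have "card (pverts G) = card U + card R"
    using card_Diff_subset[OF finR RV] card_mono[OF fin RV] by (simp add: U_def)
  ultimately show ?thesis by (simp add: algebra_simps)
qed

lemma locating_set_automorphism_iff:
  assumes f: "bij_betw f (pverts G) (pverts G)"
    and arcs: "\<And>x y. x \<in> pverts G \<Longrightarrow> y \<in> pverts G \<Longrightarrow>
      (f x, f y) \<in> parcs G \<longleftrightarrow> (x, y) \<in> parcs G"
    and R: "R \<subseteq> pverts G"
  shows "locating_set G (f ` R) \<longleftrightarrow> locating_set G R"
proof -
  have inj: "inj_on f (pverts G)" and im: "f ` pverts G = pverts G"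
    using f by (simp_all add: bij_betw_def)
  have sub: "f ` R \<subseteq> pverts G" using R im by blast
  have "pverts G - f ` R = f ` (pverts G - R)"
    using inj_on_image_set_diff[OF inj _ R] im by auto
  then have "locating_set G (f ` R) \<longleftrightarrow>
      (\<forall>x\<in>pverts G - R. \<forall>y\<in>pverts G - R. f x \<noteq> f y \<longrightarrow>
        (\<exists>z\<in>R. ((f x, f z) \<in> parcs G) \<noteq> ((f y, f z) \<in> parcs G)))"
    using sub unfolding locating_set_def by simp
  also have "\<dots> \<longleftrightarrow> (\<forall>x\<in>pverts G - R. \<forall>y\<in>pverts G - R. x \<noteq> y \<longrightarrow>
        (\<exists>z\<in>R. ((x, z) \<in> parcs G) \<noteq> ((y, z) \<in> parcs G)))"
  proof (intro ball_cong refl imp_cong bex_cong)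
    fix x y assume "x \<in> pverts G - R" "y \<in> pverts G - R"
    then show "f x \<noteq> f y \<longleftrightarrow> x \<noteq> y" using inj by (auto dest: inj_onD)
  next
    fix x y z assume "x \<in> pverts G - R" "y \<in> pverts G - R" "z \<in> R"
    then show "((f x, f z) \<in> parcs G) \<noteq> ((f y, f z) \<in> parcs G) \<longleftrightarrow>
        ((x, z) \<in> parcs G) \<noteq> ((y, z) \<in> parcs G)"
      using R arcs[of x z] arcs[of y z] by auto
  qed
  finally show ?thesis using R by (simp add: locating_set_def)
qed

section \<open>Lower bounds in cycles\<close>

lemma pverts_cycle_graph [simp]: "pverts (cycle_graph n) = {..<n}"
  by (auto simp: cycle_graph_def)

lemma parcs_cycle_graph:
  "(i, j) \<in> parcs (cycle_graph n) \<longleftrightarrow>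
     i < n \<and> j < n \<and> (j = Suc i mod n \<or> i = Suc j mod n)"
  by (simp add: cycle_graph_def)

lemma parcs_cycle_graph_commute:
  "(i, j) \<in> parcs (cycle_graph n) \<longleftrightarrow> (j, i) \<in> parcs (cycle_graph n)"
  by (auto simp: parcs_cycle_graph)

lemma pair_bidirected_digraph_cycle_graph:
  assumes "n \<ge> 3"
  shows "pair_bidirected_digraph (cycle_graph n)"
proof
  show "symmetric (with_proj (cycle_graph n))"
    by (auto simp: symmetric_def sym_def parcs_cycle_graph)
next
  fix e assume "e \<in> parcs (cycle_graph n)"
  then show "fst e \<in> pverts (cycle_graph n)" "snd e \<in> pverts (cycle_graph n)" "fst e \<noteq> snd e"
    using assms by (cases e; auto simp: parcs_cycle_graph mod_Suc split: if_splits)+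
qed

lemma rotation_eq_iff:
  "(a + i) mod n = (a + j) mod n \<longleftrightarrow> i mod n = j mod n" for a i j n :: nat
proof -
  have int_iff: "k mod n = l mod n \<longleftrightarrow> int n dvd int k - int l" for k l
    by (metis mod_eq_dvd_iff of_nat_eq_iff zmod_int)
  show ?thesis unfolding int_iff by simp
qed

lemma bij_betw_rotation: "bij_betw (\<lambda>i. (a + i) mod n) {..<n} {..<n}" for a n :: nat
proof -
  have "inj_on (\<lambda>i. (a + i) mod n) {..<n}"
    by (auto simp: inj_on_def rotation_eq_iff)
  moreover have "(\<lambda>i. (a + i) mod n) ` {..<n} \<subseteq> {..<n}"
    by auto
  ultimately show ?thesis
    unfolding bij_betw_def by (intro conjI endo_inj_surj) auto
qed

lemma parcs_cycle_graph_rotation: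
  assumes "i < n" "j < n"
  shows "((a + i) mod n, (a + j) mod n) \<in> parcs (cycle_graph n) \<longleftrightarrow> (i, j) \<in> parcs (cycle_graph n)"
proof -
  have "Suc ((a + k) mod n) mod n = (a + Suc k) mod n" for k
    by (simp add: mod_Suc_eq)
  then show ?thesis
    using assms by (simp add: parcs_cycle_graph rotation_eq_iff del: add_Suc_right)
qed

lemma locating_set_rotation_iff:
  assumes "R \<subseteq> {..<n}"
  shows "locating_set (cycle_graph n) ((\<lambda>i. (a + i) mod n) ` R) \<longleftrightarrow>
    locating_set (cycle_graph n) R"
  using assms bij_betw_rotation[of a n]
  by (intro locating_set_automorphism_iff) (auto simp: parcs_cycle_graph_rotation)

lemma card_neighbours_cycle_graph_le:
  "card {x \<in> pverts (cycle_graph n). (x, z) \<in> parcs (cycle_graph n)} \<le> 2"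
proof -
  have "{x \<in> pverts (cycle_graph n). (x, z) \<in> parcs (cycle_graph n)}
      \<subseteq> {Suc z mod n, if z = 0 then n - 1 else z - 1}"
    by (auto simp: parcs_cycle_graph mod_Suc split: if_splits)
  then have "card {x \<in> pverts (cycle_graph n). (x, z) \<in> parcs (cycle_graph n)}
      \<le> card {Suc z mod n, if z = 0 then n - 1 else z - 1}"
    by (intro card_mono) auto
  also have "\<dots> \<le> 2" by (simp add: card_insert_if)
  finally show ?thesis .
qed

lemma locating_set_cycle_graph_card_bound:
  assumes "locating_set (cycle_graph n) R"
  shows "2 * n \<le> 5 * card R + 2"
  using locating_set_card_bound[OF assms, of 2] card_neighbours_cycle_graph_le[of n] by simp

text \<open>
  A connected set of rim vertices is an arc. Its complement is an arc too, and all vertices of that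
  arc except its two ends have empty code; only one vertex may have an empty code, so the
  complement has at most three vertices.
\<close>

lemma connected_locating_set_cycle_graph_card_bound:
  assumes loc: "locating_set (cycle_graph n) R"
    and cut: "\<And>X. X \<subseteq> R \<Longrightarrow> X \<noteq> {} \<Longrightarrow> X \<noteq> R \<Longrightarrow>
      \<exists>x\<in>X. \<exists>y\<in>R - X. (x, y) \<in> parcs (cycle_graph n)"
  shows "n \<le> card R + 3"
proof (cases "R = {} \<or> R = {..<n}")
  case True
  then show ?thesis using locating_set_cycle_graph_card_bound[OF loc] by auto
next
  case False
  have R: "R \<subseteq> {..<n}" using loc by (simp add: locating_set_def)
  obtain s where s: "s \<in> R" "Suc s mod n \<notin> R"
  proof (rule ccontr)
    assume "\<not> thesis"
    with that have step: "Suc s mod n \<in> R" if "s \<in> R" for s using that by blast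
    obtain r where r: "r \<in> R" using False by blast
    have "(r + k) mod n \<in> R" for k
    proof (induction k)
      case 0 then show ?case using r R by (auto simp: subset_iff)
    next
      case (Suc k) then show ?case using step[OF Suc] by (simp add: mod_Suc_eq)
    qed
    then have "(\<lambda>k. (r + k) mod n) ` {..<n} \<subseteq> R" by blast
    then have "{..<n} \<subseteq> R" using bij_betw_rotation[of r n] by (simp add: bij_betw_def)
    then show False using R False by blast
  qed
  \<comment> \<open>Renumber the cycle so that 0 lies outside the set and its predecessor \<open>n - 1\<close> inside.\<close>
  define f where "f i = (Suc s + i) mod n" for i
  have f: "bij_betw f {..<n} {..<n}" unfolding f_def by (rule bij_betw_rotation)
  define P where "P = {p \<in> {..<n}. f p \<in> R}"
  have n: "s < n" using s R by blast
  have P: "P \<subseteq> {..<n}" by (auto simp: P_def)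
  have fP: "f ` P = R"
  proof
    show "f ` P \<subseteq> R" by (auto simp: P_def)
    show "R \<subseteq> f ` P"
    proof
      fix z assume "z \<in> R"
      then have "z \<in> f ` {..<n}" using f R by (auto simp: bij_betw_def)
      then show "z \<in> f ` P" using \<open>z \<in> R\<close> by (auto simp: P_def)
    qed
  qed
  have injP: "inj_on f P" using f P by (auto simp: bij_betw_def inj_on_def)
  have cardP: "card P = card R" using card_image[OF injP] fP by simp
  have locP: "locating_set (cycle_graph n) P"
    using loc locating_set_rotation_iff[OF P, of "Suc s"] fP by (simp add: f_def)
  have P0: "0 \<notin> P" using s by (simp add: P_def f_def)
  have "f (n - 1) = s" using n by (simp add: f_def)
  then have Plast: "n - 1 \<in> P" using s n by (simp add: P_def)
  define b where "b = (LEAST p. p \<in> P)"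
  have b: "b \<in> P" unfolding b_def using Plast by (rule LeastI)
  have below: "p \<notin> P" if "p < b" for p using that not_less_Least unfolding b_def by blast
  \<comment> \<open>A missing vertex between \<open>b\<close> and \<open>n - 1\<close>, together with 0, would cut the set in two.\<close>
  have run: "{b..<n} \<subseteq> P"
  proof (rule ccontr)
    assume "\<not> {b..<n} \<subseteq> P"
    then obtain q where q: "b \<le> q" "q < n" "q \<notin> P"
      by (meson atLeastLessThan_iff subsetI)
    define X where "X = {p \<in> P. p < q}"
    have XP: "X \<subseteq> P" by (auto simp: X_def)
    have X1: "b \<in> X" using b q by (cases "b = q") (auto simp: X_def)
    have X2: "n - 1 \<notin> X" using q by (auto simp: X_def)
    have "f ` X \<noteq> f ` P"
      using inj_on_image_eq_iff[OF injP XP order.refl] X2 Plast by blast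
    then obtain x y where xy: "x \<in> f ` X" "y \<in> R - f ` X" "(x, y) \<in> parcs (cycle_graph n)"
      using cut[of "f ` X"] XP X1 fP by blast
    then obtain p p' where p: "p \<in> X" "p' \<in> P - X" "(f p, f p') \<in> parcs (cycle_graph n)"
      using fP by blast
    then have "p < n" "p' < n" using P XP by auto
    with p have "(p, p') \<in> parcs (cycle_graph n)"
      using parcs_cycle_graph_rotation[of p n p' "Suc s"] by (simp add: f_def)
    moreover have "p < q" "p > 0" using p P0 by (auto simp: X_def intro: gr0I)
    moreover have "p' > q" using p q by (cases p' q rule: linorder_cases) (auto simp: X_def)
    ultimately show False
      by (auto simp: parcs_cycle_graph mod_Suc split: if_splits)
  qed
  have "b \<le> 3"
  proof (rule ccontr)
    assume "\<not> b \<le> 3"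
    then have b4: "4 \<le> b" by simp
    have "b < n" using b P by blast
    \<comment> \<open>The neighbours 0, 1, 2, 3 of 1 and 2 all lie below \<open>b\<close>, so 1 and 2 both have empty codes.\<close>
    obtain z where "z \<in> P"
        "((1, z) \<in> parcs (cycle_graph n)) \<noteq> ((2, z) \<in> parcs (cycle_graph n))"
      by (rule locating_setE[OF locP, of 1 2]) (use b4 \<open>b < n\<close> below in auto)
    moreover have "b \<le> z" using \<open>z \<in> P\<close> below not_less by blast
    ultimately show False
      using b4 \<open>b < n\<close> by (auto simp: parcs_cycle_graph mod_Suc split: if_splits)
  qed
  moreover have "n - b \<le> card P"
    using card_mono[OF _ run] finite_subset[OF P] by simp
  ultimately show ?thesis using cardP by simp
qed

section \<open>Small locating sets in cycles\<close>

text \<open>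
  Two vertices of a long cycle share a neighbour only if they are two steps apart. If such a pair
  \<open>i + 1\<close>, \<open>i + 3\<close> outside \<open>R\<close> has equal codes, then \<open>i\<close> and \<open>i + 4\<close> are outside \<open>R\<close> as well, which
  \<open>flank\<close> forbids. For all other pairs equal codes must both be empty, so that \<open>R\<close> avoids two
  runs of three consecutive vertices; \<open>gap\<close> leaves only one starting point for such a run.
\<close>

lemma locating_set_cycle_graphI:
  assumes n: "n \<ge> 5" and R: "R \<subseteq> {..<n}"
    and flank: "\<And>i. i < n \<Longrightarrow>
      i \<in> R \<or> (i + 1) mod n \<in> R \<or> (i + 3) mod n \<in> R \<or> (i + 4) mod n \<in> R"
    and gap: "\<And>i. i < n \<Longrightarrow> i \<notin> R \<Longrightarrow> (i + 1) mod n \<notin> R \<Longrightarrow> (i + 2) mod n \<notin> R \<Longrightarrow> i = c"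
  shows "locating_set (cycle_graph n) R"
  unfolding locating_set_def
proof (intro conjI ballI impI)
  show "R \<subseteq> pverts (cycle_graph n)" using R by simp
next
  fix x y
  assume x: "x \<in> pverts (cycle_graph n) - R" and y: "y \<in> pverts (cycle_graph n) - R"
    and "x \<noteq> y"
  \<comment> \<open>The conditions on \<open>R\<close> speak of windows, so pairs are indexed by the predecessors of their elements.\<close>
  define pr where "pr x = (if x = 0 then n - 1 else x - 1)" for x
  define i j where "i = pr x" and "j = pr y"
  have i: "i < n" "x = (i + 1) mod n" and j: "j < n" "y = (j + 1) mod n"
    using x y n by (auto simp: i_def j_def pr_def)
  have eq_iff: "(k + a) mod n = (k + b) mod n \<longleftrightarrow> a = b" if "a \<le> 4" "b \<le> 4" for k a b
    using that n by (simp add: rotation_eq_iff)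
  have adj: "((k + 1) mod n, z) \<in> parcs (cycle_graph n) \<longleftrightarrow> z = k \<or> z = (k + 2) mod n"
    if "k < n" "z < n" for k z
    using that n by (auto simp: parcs_cycle_graph mod_Suc split: if_splits)
  show "\<exists>z\<in>R. ((x, z) \<in> parcs (cycle_graph n)) \<noteq> ((y, z) \<in> parcs (cycle_graph n))"
  proof (rule ccontr)
    assume "\<not> ?thesis"
    then have same: "z = i \<or> z = (i + 2) mod n \<longleftrightarrow> z = j \<or> z = (j + 2) mod n" if "z \<in> R" for z
      using that adj i j R by (metis lessThan_iff subset_iff)
    have two_apart: False if k: "k < n" "(k + 1) mod n \<notin> R" "(k + 3) mod n \<notin> R"
      and same: "\<And>z. z \<in> R \<Longrightarrow> z = k \<or> z = (k + 2) mod n \<longleftrightarrow> z = (k + 2) mod n \<or> z = (k + 4) mod n"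
      for k
    proof -
      have "k = (k + 0) mod n" using k by simp
      then have "k \<noteq> (k + 2) mod n" "k \<noteq> (k + 4) mod n" "(k + 4) mod n \<noteq> (k + 2) mod n"
        using eq_iff[of 0 2 k] eq_iff[of 0 4 k] eq_iff[of 4 2 k] by auto
      then show False using flank[OF k(1)] k same[of k] same[of "(k + 4) mod n"] by auto
    qed
    have shift: "((k + 2) mod n + 1) mod n = (k + 3) mod n"
        "((k + 2) mod n + 2) mod n = (k + 4) mod n" for k
      unfolding mod_add_left_eq by (simp_all add: add.assoc del: add_2_eq_Suc' One_nat_def)
    consider "j = (i + 2) mod n" | "i = (j + 2) mod n"
      | "j \<noteq> (i + 2) mod n" "i \<noteq> (j + 2) mod n" by blast
    then show False
    proof cases
      case 1
      have y3: "y = (i + 3) mod n" unfolding j(2) 1 by (rule shift)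
      have j4: "(j + 2) mod n = (i + 4) mod n" unfolding 1 by (rule shift)
      show False
      proof (rule two_apart[OF i(1)])
        show "(i + 1) mod n \<notin> R" using x i by simp
        show "(i + 3) mod n \<notin> R" using y y3 by simp
        fix z assume "z \<in> R"
        then show "z = i \<or> z = (i + 2) mod n \<longleftrightarrow> z = (i + 2) mod n \<or> z = (i + 4) mod n"
          using same j4 1 by metis
      qed
    next
      case 2
      have x3: "x = (j + 3) mod n" unfolding i(2) 2 by (rule shift)
      have i4: "(i + 2) mod n = (j + 4) mod n" unfolding 2 by (rule shift)
      show False
      proof (rule two_apart[OF j(1)])
        show "(j + 1) mod n \<notin> R" using y j by simp
        show "(j + 3) mod n \<notin> R" using x x3 by simp
        fix z assume "z \<in> R"
        then show "z = j \<or> z = (j + 2) mod n \<longleftrightarrow> z = (j + 2) mod n \<or> z = (j + 4) mod n"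
          using same i4 2 by metis
      qed
    next
      case 3
      have "i \<noteq> j" using i j \<open>x \<noteq> y\<close> by blast
      then have ne: "(i + 2) mod n \<noteq> (j + 2) mod n"
        using i j rotation_eq_iff[of 2 i n j] by (simp add: add.commute)
      have "i \<notin> R" "(i + 2) mod n \<notin> R" "j \<notin> R" "(j + 2) mod n \<notin> R"
        using same[of i] same[of "(i + 2) mod n"] same[of j] same[of "(j + 2) mod n"] 3 ne \<open>i \<noteq> j\<close>
        by auto
      then have "i = c" "j = c" using gap[of i] gap[of j] i j x y by auto
      then show False using \<open>i \<noteq> j\<close> by simp
    qed
  qed
qed

text \<open>
  With 0 and 2 in \<open>R\<close>, every window that wraps around the end of the cycle meets \<open>R\<close> automatically,
  so the two conditions need to be checked only where no reduction modulo \<open>n\<close> takes place.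
\<close>

lemma locating_set_cycle_graphI_linear:
  assumes n: "n \<ge> 5" and R: "R \<subseteq> {..<n}" "0 \<in> R" "2 \<in> R"
    and flank: "\<And>i. i + 4 < n \<Longrightarrow> i \<in> R \<or> i + 1 \<in> R \<or> i + 3 \<in> R \<or> i + 4 \<in> R"
    and gap: "\<And>i. i + 2 < n \<Longrightarrow> i \<notin> R \<Longrightarrow> i + 1 \<notin> R \<Longrightarrow> i + 2 \<notin> R \<Longrightarrow> i = c"
  shows "locating_set (cycle_graph n) R"
proof (rule locating_set_cycle_graphI[OF n R(1)])
  have wrap: "(i + k) mod n = i + k - n" if "i < n" "n \<le> i + k" "k \<le> n" for i k
    using that by (simp add: mod_if)
  fix i assume i: "i < n"
  consider "i + 4 < n" | "i + 4 = n" | "i + 3 = n" | "i + 2 = n" | "i + 1 = n"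
    using i by linarith
  then show "i \<in> R \<or> (i + 1) mod n \<in> R \<or> (i + 3) mod n \<in> R \<or> (i + 4) mod n \<in> R"
  proof cases
    case 1
    then show ?thesis using flank[of i] by simp
  next
    case 4
    then have "(i + 4) mod n = 2" using wrap[of i 4] n by simp
    then show ?thesis using R by simp
  qed (use R in simp_all)
  assume out: "i \<notin> R" "(i + 1) mod n \<notin> R" "(i + 2) mod n \<notin> R"
  consider "i + 2 < n" | "i + 2 = n" | "i + 1 = n"
    using i by linarith
  then show "i = c"
    using out gap[of i] R by cases simp_all
qed

text \<open>
  Equality in the counting bound asks for a private neighbour of every element of \<open>R\<close> and one
  vertex with empty code. Hence the gaps between consecutive elements of \<open>R\<close> should be 1 and 2
  alternately, which has period 5, with one gap allowed to grow to 3: it is the one that starts at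
  \<open>5 * m - 2\<close> and ends at \<open>n - 1\<close>.
\<close>

lemma ex_locating_set_cycle_graph_even:
  assumes m: "m \<ge> 1" and n: "5 * m - 1 \<le> n" "n \<le> 5 * m + 1" "n \<ge> 5"
  shows "\<exists>R. locating_set (cycle_graph n) R \<and> 0 \<in> R \<and> card R \<le> 2 * m"
proof -
  define R where "R = (\<lambda>t. 5 * t) ` {..<m} \<union> (\<lambda>t. 5 * t + 2) ` {..<m}"
  have "card R \<le> m + m" unfolding R_def
    by (intro order.trans[OF card_Un_le] add_mono order.trans[OF card_image_le]) auto
  then have card: "card R \<le> 2 * m" by simp
  have mem: "t < m \<Longrightarrow> 5 * t \<in> R" "t < m \<Longrightarrow> 5 * t + 2 \<in> R" for t
    by (auto simp: R_def)
  then have mem': "t + 1 < m \<Longrightarrow> 5 * t + 5 \<in> R" "t + 1 < m \<Longrightarrow> 5 * t + 7 \<in> R" for t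
    using mem[of "t + 1"] by (simp_all add: algebra_simps)
  have zero: "0 \<in> R" using mem(1)[of 0] m by simp
  have split: "\<exists>t. i = 5 * t \<or> i = 5 * t + 1 \<or> i = 5 * t + 2 \<or> i = 5 * t + 3 \<or> i = 5 * t + 4"
    for i :: nat by presburger
  have "locating_set (cycle_graph n) R"
  proof (rule locating_set_cycle_graphI_linear[where c = "5 * m - 2"])
    show "5 \<le> n" by (rule n)
    show "R \<subseteq> {..<n}" using n by (auto simp: R_def)
    show "0 \<in> R" by (rule zero)
    show "2 \<in> R" using mem(2)[of 0] m by (simp add: numeral_2_eq_2)
  next
    fix i assume i: "i + 4 < n"
    obtain t where "i = 5 * t \<or> i = 5 * t + 1 \<or> i = 5 * t + 2 \<or> i = 5 * t + 3 \<or> i = 5 * t + 4"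
      using split by blast
    then show "i \<in> R \<or> i + 1 \<in> R \<or> i + 3 \<in> R \<or> i + 4 \<in> R"
      using i n mem[of t] mem'[of t] by (elim disjE) (simp_all add: add.assoc del: One_nat_def add_2_eq_Suc')
  next
    fix i assume i: "i + 2 < n" "i \<notin> R" "i + 1 \<notin> R" "i + 2 \<notin> R"
    obtain t where "i = 5 * t \<or> i = 5 * t + 1 \<or> i = 5 * t + 2 \<or> i = 5 * t + 3 \<or> i = 5 * t + 4"
      using split by blast
    then show "i = 5 * m - 2"
      using i n mem[of t] mem'[of t] by (cases "t + 1 < m"; elim disjE)
        (simp_all add: add.assoc del: One_nat_def add_2_eq_Suc')
  qed
  with zero card show ?thesis by blast
qed

text \<open>
  Between two gaps of length at least 2 an element would have two neighbours with the same singleton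
  code, so the lengths 1 and 2 cannot alternate all the way around an odd number of elements. Here
  the gaps after 0 and after 2 both have length 1, and the gap that may have length 3 runs from
  \<open>5 * m\<close> to \<open>n - 1\<close>.
\<close>

lemma ex_locating_set_cycle_graph_odd:
  assumes m: "m \<ge> 1" and n: "5 * m + 2 \<le> n" "n \<le> 5 * m + 3"
  shows "\<exists>R. locating_set (cycle_graph n) R \<and> 0 \<in> R \<and> card R \<le> 2 * m + 1"
proof -
  define R where "R = insert 0 ((\<lambda>t. 5 * t + 2) ` {..<m} \<union> (\<lambda>t. 5 * t + 4) ` {..<m})"
  have "card ((\<lambda>t. 5 * t + 2) ` {..<m} \<union> (\<lambda>t. 5 * t + 4) ` {..<m}) \<le> m + m"
    by (intro order.trans[OF card_Un_le] add_mono order.trans[OF card_image_le]) auto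
  then have card: "card R \<le> 2 * m + 1"
    unfolding R_def by (simp add: card_insert_if)
  have mem: "t < m \<Longrightarrow> 5 * t + 2 \<in> R" "t < m \<Longrightarrow> 5 * t + 4 \<in> R" for t
    by (auto simp: R_def)
  then have mem': "t + 1 < m \<Longrightarrow> 5 * t + 7 \<in> R" "t + 1 < m \<Longrightarrow> 5 * t + 9 \<in> R" for t
    using mem[of "t + 1"] by (simp_all add: algebra_simps)
  have zero: "0 \<in> R" by (simp add: R_def)
  have split: "\<exists>t. i = 5 * t \<or> i = 5 * t + 1 \<or> i = 5 * t + 2 \<or> i = 5 * t + 3 \<or> i = 5 * t + 4"
    for i :: nat by presburger
  have "locating_set (cycle_graph n) R"
  proof (rule locating_set_cycle_graphI_linear[where c = "5 * m"])
    show "5 \<le> n" using m n by simp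
    show "R \<subseteq> {..<n}" using n by (auto simp: R_def)
    show "0 \<in> R" by (rule zero)
    show "2 \<in> R" using mem(1)[of 0] m by (simp add: numeral_2_eq_2)
  next
    fix i assume i: "i + 4 < n"
    obtain t where "i = 5 * t \<or> i = 5 * t + 1 \<or> i = 5 * t + 2 \<or> i = 5 * t + 3 \<or> i = 5 * t + 4"
      using split by blast
    then show "i \<in> R \<or> i + 1 \<in> R \<or> i + 3 \<in> R \<or> i + 4 \<in> R"
      using i n mem[of t] mem'[of t] by (elim disjE) (simp_all add: add.assoc del: One_nat_def add_2_eq_Suc')
  next
    fix i assume i: "i + 2 < n" "i \<notin> R" "i + 1 \<notin> R" "i + 2 \<notin> R"
    obtain t where "i = 5 * t \<or> i = 5 * t + 1 \<or> i = 5 * t + 2 \<or> i = 5 * t + 3 \<or> i = 5 * t + 4"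
      using split by blast
    then show "i = 5 * m"
      using i n mem[of t] mem'[of t] by (cases "t < m"; elim disjE)
        (simp_all add: add.assoc del: One_nat_def add_2_eq_Suc')
  qed
  with zero card show ?thesis by blast
qed

lemma adjacent_pair_locating_set:
  assumes "n \<in> {4, 5}"
  shows "locating_set (cycle_graph n) {0, 1}"
proof -
  have rest: "{..<4} - {0, 1} = {2, 3 :: nat}" "{..<5} - {0, 1} = {2, 3, 4 :: nat}" by auto
  have "n = 4 \<or> n = 5" using assms by simp
  then show ?thesis
  proof
    assume "n = 4"
    then show ?thesis
      unfolding locating_set_def pverts_cycle_graph \<open>n = 4\<close> rest by (simp add: parcs_cycle_graph)
  next
    assume "n = 5"
    then show ?thesis
      unfolding locating_set_def pverts_cycle_graph \<open>n = 5\<close> rest by (simp add: parcs_cycle_graph)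
  qed
qed

text \<open>
  With \<open>k = (2 * n + 2) div 5\<close> one has \<open>2 * n - 2 \<le> 5 * k \<le> 2 * n + 2\<close>, which for \<open>k = 2 * m\<close> and
  for \<open>k = 2 * m + 1\<close> leaves exactly the ranges of \<open>n\<close> covered by the two periodic constructions.
\<close>

lemma ex_optimal_locating_set_cycle_graph:
  assumes "n \<ge> 6"
  shows "\<exists>R. locating_set (cycle_graph n) R \<and> 0 \<in> R \<and> card R \<le> (2 * n + 2) div 5"
proof -
  define k m where "k = (2 * n + 2) div 5" and "m = k div 2"
  have m: "m \<ge> 1" using assms by (simp add: k_def m_def)
  consider "k = 2 * m" | "k = 2 * m + 1" unfolding m_def by linarith
  then show ?thesis
  proof cases
    case 1
    then have "5 * m - 1 \<le> n" "n \<le> 5 * m + 1" unfolding k_def by linarith+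
    then show ?thesis using ex_locating_set_cycle_graph_even[OF m, of n] assms 1
      by (simp add: k_def)
  next
    case 2
    then have "5 * m + 2 \<le> n" "n \<le> 5 * m + 3" unfolding k_def by linarith+
    then show ?thesis using ex_locating_set_cycle_graph_odd[OF m, of n] 2
      by (simp add: k_def)
  qed
qed

section \<open>Connected resolving sets of wheels\<close>

lemma cdim_eqI:
  assumes "connected_resolving_set G S" "card S \<le> k"
    and "\<And>T. connected_resolving_set G T \<Longrightarrow> k \<le> card T"
  shows "cdim G = k"
  unfolding cdim_def using assms by (intro Least_equality) (auto intro!: exI[of _ S] antisym)

lemma cdim_at_eqI:
  assumes "connected_resolving_set G S" "v \<in> S" "card S \<le> k"
    and "\<And>T. connected_resolving_set G T \<Longrightarrow> v \<in> T \<Longrightarrow> k \<le> card T"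
  shows "cdim_at G v = k"
  unfolding cdim_at_def using assms by (intro Least_equality) (auto intro!: exI[of _ S] antisym)

lemma connected_resolving_set_join_K1_insert_iff:
  assumes "pair_bidirected_digraph G"
  shows "connected_resolving_set (with_proj (join_K1 G)) (insert None (Some ` R)) \<longleftrightarrow>
    locating_set G R"
proof -
  have "Digraph_Component.connected (with_proj (join_K1 G) \<restriction> insert None (Some ` R))"
    if "locating_set G R"
    using that by (intro connected_induced_join_K1) (auto simp: locating_set_def)
  then show ?thesis
    unfolding connected_resolving_set_def resolving_set_join_K1_iff[OF assms]
      locating_set_join_K1_insert_iff by blast
qed

lemma hub_connected_resolving_set_card_bound:
  assumes n: "n \<ge> 3" and S: "connected_resolving_set (with_proj (wheel_graph n)) S"
    and hub: "hub \<in> S"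
  shows "2 * n + 3 \<le> 5 * card S"
proof -
  define R where "R = {i. Some i \<in> S}"
  have SR: "S = insert None (Some ` R)"
    using hub by (auto simp: R_def image_iff) (metis option.exhaust)
  then have loc: "locating_set (cycle_graph n) R"
    using S connected_resolving_set_join_K1_insert_iff[OF pair_bidirected_digraph_cycle_graph[OF n]]
    by (simp add: wheel_graph_def)
  then have "finite R"
    by (auto simp: locating_set_def intro: finite_subset)
  then have "card S = Suc (card R)"
    unfolding SR by (simp add: card_image)
  then show ?thesis using locating_set_cycle_graph_card_bound[OF loc] by simp
qed

lemma rim_connected_resolving_set_card_bound:
  assumes n: "n \<ge> 3" and S: "connected_resolving_set (with_proj (wheel_graph n)) S"
    and hub: "hub \<notin> S"
  shows "2 * n \<le> 5 * card S + 2" "n \<le> card S + 3"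
proof -
  define R where "R = {i. Some i \<in> S}"
  have SR: "S = Some ` R"
    using hub by (auto simp: R_def image_iff) (metis option.exhaust)
  have loc: "locating_set (cycle_graph n) R"
    using S resolving_set_join_K1_iff[OF pair_bidirected_digraph_cycle_graph[OF n]]
    by (simp add: connected_resolving_set_def wheel_graph_def SR locating_set_join_K1_image_iff)
  have conn: "Digraph_Component.connected (with_proj (wheel_graph n) \<restriction> S)"
    using S by (simp add: connected_resolving_set_def)
  have card: "card S = card R"
    unfolding SR by (simp add: card_image)
  show "2 * n \<le> 5 * card S + 2"
    using locating_set_cycle_graph_card_bound[OF loc] card by simp
  have "n \<le> card R + 3"
  proof (rule connected_locating_set_cycle_graph_card_bound[OF loc])
    fix X assume X: "X \<subseteq> R" "X \<noteq> {}" "X \<noteq> R"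
    have sub: "Some ` X \<subseteq> S" and nonempty: "Some ` X \<noteq> {}" and proper: "Some ` X \<noteq> S"
      using X by (auto simp: SR inj_image_eq_iff)
    obtain x y where xy: "x \<in> Some ` X" "y \<in> S - Some ` X"
        "(x, y) \<in> parcs (wheel_graph n) \<or> (y, x) \<in> parcs (wheel_graph n)"
      by (rule connected_imp_crossing_arc[OF conn sub nonempty proper])
    obtain i where i: "i \<in> X" "x = Some i" using xy(1) by blast
    obtain j where j: "j \<in> R - X" "y = Some j" using xy(2) SR by blast
    have "(i, j) \<in> parcs (cycle_graph n) \<or> (j, i) \<in> parcs (cycle_graph n)"
      using xy(3) i(2) j(2) by (simp add: wheel_graph_def)
    then show "\<exists>i\<in>X. \<exists>j\<in>R - X. (i, j) \<in> parcs (cycle_graph n)"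
      using i(1) j(1) parcs_cycle_graph_commute by blast
  qed
  then show "n \<le> card S + 3" using card by simp
qed

text \<open>
  By rotating \<open>R\<close>, the vertex 0 can be moved to any prescribed rim vertex. This is why the minimum
  with a prescribed vertex agrees with the unrestricted one as soon as the hub is in an optimal set.
\<close>

lemma ex_hub_connected_resolving_set:
  assumes n: "n \<ge> 3" and loc: "locating_set (cycle_graph n) R" and zero: "0 \<in> R"
    and v: "v \<in> pverts (wheel_graph n)"
  shows "\<exists>S. connected_resolving_set (with_proj (wheel_graph n)) S \<and> hub \<in> S \<and> v \<in> S \<and>
    card S \<le> card R + 1"
proof -
  define a where "a = (case v of None \<Rightarrow> 0 | Some a \<Rightarrow> a)"
  define R' where "R' = (\<lambda>i. (a + i) mod n) ` R"
  have R: "R \<subseteq> {..<n}" using loc by (simp add: locating_set_def)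
  have "locating_set (cycle_graph n) R'"
    unfolding R'_def using loc locating_set_rotation_iff[OF R] by simp
  then have "connected_resolving_set (with_proj (wheel_graph n)) (insert None (Some ` R'))"
    using connected_resolving_set_join_K1_insert_iff[OF pair_bidirected_digraph_cycle_graph[OF n]]
    by (simp add: wheel_graph_def)
  moreover have "v \<in> insert None (Some ` R')"
  proof (cases v)
    case (Some i)
    then have "i < n" using v by (auto simp: wheel_graph_def)
    then have "i \<in> R'" using zero Some by (auto simp: R'_def a_def intro!: image_eqI[of _ _ 0])
    then show ?thesis using Some by simp
  qed simp
  moreover have "card (insert None (Some ` R')) \<le> card R + 1"
  proof -
    have "finite R" using R finite_subset by blast
    then have "card R' \<le> card R" "finite R'" by (auto simp: R'_def card_image_le)
    then show ?thesis by (simp add: card_image)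
  qed
  ultimately show ?thesis by blast
qed

text \<open>
  \<open>W\<^sub>3\<close> is the complete graph on four vertices, where no two vertices outside a set can be told
  apart by it.
\<close>

lemma resolving_set_wheel_graph_3_card_bound:
  assumes "resolving_set (with_proj (wheel_graph 3)) S"
  shows "3 \<le> card S"
proof -
  let ?V = "pverts (wheel_graph 3)"
  have V: "?V = insert None (Some ` {..<3})" by (simp add: wheel_graph_def)
  have adj: "(x, y) \<in> parcs (wheel_graph 3)" if "x \<in> ?V" "y \<in> ?V" "x \<noteq> y" for x y
  proof -
    have "(i, j) \<in> parcs (cycle_graph 3)" if "i < 3" "j < 3" "i \<noteq> j" for i j
    proof -
      have "i = 0 \<or> i = 1 \<or> i = 2" "j = 0 \<or> j = 1 \<or> j = 2" using that by linarith+
      then show ?thesis using \<open>i \<noteq> j\<close> by (elim disjE) (simp_all add: parcs_cycle_graph)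
    qed
    then show ?thesis
      using that unfolding wheel_graph_def pverts_join_K1 pverts_cycle_graph
      by (cases x; cases y) auto
  qed
  have loc: "locating_set (wheel_graph 3) S"
    using assms resolving_set_join_K1_iff[OF pair_bidirected_digraph_cycle_graph[of 3]]
    by (simp add: wheel_graph_def)
  then have S: "S \<subseteq> ?V" by (simp add: locating_set_def)
  have "x = y" if x: "x \<in> ?V" "x \<notin> S" and y: "y \<in> ?V" "y \<notin> S" for x y
  proof (rule ccontr)
    assume "x \<noteq> y"
    obtain z where z: "z \<in> S"
        "((x, z) \<in> parcs (wheel_graph 3)) \<noteq> ((y, z) \<in> parcs (wheel_graph 3))"
      by (rule locating_setE[OF loc x y \<open>x \<noteq> y\<close>])
    have "z \<in> ?V" "x \<noteq> z" "y \<noteq> z" using z(1) S x y by auto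
    then show False using z(2) adj[OF x(1)] adj[OF y(1)] by simp
  qed
  moreover have "finite ?V" by (simp add: V)
  ultimately have "card (?V - S) \<le> Suc 0"
    by (subst card_le_Suc0_iff_eq) (auto simp del: pverts_join_K1)
  moreover have "card ?V = 4" by (simp add: V card_image)
  ultimately show ?thesis
    using card_Diff_subset[OF finite_subset[OF S \<open>finite ?V\<close>] S] by simp
qed

text \<open>
  For \<open>n = 4\<close> and \<open>n = 5\<close> the complement of a rim edge is so short that at most one rim vertex has an
  empty code, and no rim vertex is adjacent to both ends of the edge, as the hub is.
\<close>

lemma adjacent_rim_pair_connected_resolving_set:
  assumes n: "n \<in> {4, 5}" and v: "v < n"
  shows "connected_resolving_set (with_proj (wheel_graph n)) {Some v, Some (Suc v mod n)}"
proof -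
  have "pair_bidirected_digraph (cycle_graph n)"
    using n by (intro pair_bidirected_digraph_cycle_graph) auto
  note res = resolving_set_join_K1_iff[OF this]
  have adj: "(Some v, Some (Suc v mod n)) \<in> parcs (wheel_graph n)"
    using v by (simp add: wheel_graph_def parcs_cycle_graph)
  define R where "R = (\<lambda>i. (v + i) mod n) ` {0, 1}"
  have R: "R = {v, Suc v mod n}" using v by (simp add: R_def)
  have "locating_set (cycle_graph n) R"
    unfolding R_def using n adjacent_pair_locating_set[OF n]
    by (subst locating_set_rotation_iff) auto
  moreover have "\<exists>z\<in>R. (x, z) \<notin> parcs (cycle_graph n)" if "x \<in> {..<n} - R" for x
    using that n v unfolding R
    by (auto simp: parcs_cycle_graph mod_Suc split: if_splits)
  ultimately have "locating_set (join_K1 (cycle_graph n)) (Some ` R)"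
    by (simp add: locating_set_join_K1_image_iff)
  then show ?thesis
    using connected_induced_adjacent_pair[OF adj] res[of "Some ` R"]
    by (simp add: connected_resolving_set_def R wheel_graph_def)
qed

theorem proposition5p8:
  fixes n :: nat and v :: "nat option"
  assumes "n \<ge> 3" and "v \<in> pverts (wheel_graph n)"
  shows "(n = 3 \<longrightarrow>
            cdim (with_proj (wheel_graph n)) = 3 \<and>
            cdim_at (with_proj (wheel_graph n)) v = 3) \<and>
         (n \<in> {4, 5} \<longrightarrow>
            cdim (with_proj (wheel_graph n)) = 2 \<and>
            (v \<noteq> hub \<longrightarrow> cdim_at (with_proj (wheel_graph n)) v = 2) \<and>
            cdim_at (with_proj (wheel_graph n)) hub = 3) \<and>
         (n \<ge> 6 \<longrightarrow>
            int (cdim (with_proj (wheel_graph n))) = \<lfloor>(2 * real n + 2) / 5\<rfloor> + 1 \<and>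
            int (cdim_at (with_proj (wheel_graph n)) v) = \<lfloor>(2 * real n + 2) / 5\<rfloor> + 1)"
proof (intro conjI impI)
  let ?W = "with_proj (wheel_graph n)"
  note hub_bound = hub_connected_resolving_set_card_bound[OF assms(1)]
  note rim_bound = rim_connected_resolving_set_card_bound[OF assms(1)]
  {
    assume n: "n = 3"
    have "{..<3} - {0, 1} = {2::nat}" by auto
    then have "locating_set (cycle_graph n) {0, 1}"
      by (auto simp: n locating_set_def)
    then obtain S where S: "connected_resolving_set ?W S" "v \<in> S" "card S \<le> 3"
      using ex_hub_connected_resolving_set[OF assms(1) _ _ assms(2), of "{0, 1}"] by auto
    have low: "3 \<le> card T" if "connected_resolving_set ?W T" for T
      using that resolving_set_wheel_graph_3_card_bound n
      by (simp add: connected_resolving_set_def)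
    show "cdim ?W = 3" using S low by (intro cdim_eqI)
    show "cdim_at ?W v = 3" using S low by (intro cdim_at_eqI)
  next
    assume n: "n \<in> {4, 5}"
    have low_hub: "3 \<le> card T" if "connected_resolving_set ?W T" "hub \<in> T" for T
      using hub_bound[OF that] n by auto
    have low: "2 \<le> card T" if "connected_resolving_set ?W T" for T
      using low_hub[OF that] rim_bound(1)[OF that] n by (cases "hub \<in> T") auto
    have pair: "connected_resolving_set ?W {Some i, Some (Suc i mod n)}"
        "card {Some i, Some (Suc i mod n)} \<le> 2" if "i < n" for i
      using adjacent_rim_pair_connected_resolving_set[OF n that] by (auto simp: card_insert_if)
    show "cdim ?W = 2"
      using pair[of 0] low n by (intro cdim_eqI) auto
    show "cdim_at ?W v = 2" if rim: "v \<noteq> hub"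
    proof -
      obtain i where i: "v = Some i" "i < n"
        using rim assms(2) by (auto simp: wheel_graph_def)
      show ?thesis
        using pair[OF i(2)] low i(1) by (intro cdim_at_eqI) auto
    qed
    obtain S where "connected_resolving_set ?W S" "hub \<in> S" "card S \<le> 3"
      using ex_hub_connected_resolving_set[OF assms(1) adjacent_pair_locating_set[OF n],
          where v = hub]
      by (auto simp: wheel_graph_def)
    then show "cdim_at ?W hub = 3" using low_hub by (intro cdim_at_eqI)
  next
    assume n: "n \<ge> 6"
    define k where "k = (2 * n + 2) div 5"
    have floor: "\<lfloor>(2 * real n + 2) / 5\<rfloor> = int k"
      using floor_divide_of_nat_eq[of "2 * n + 2" 5, where 'a = real] by (simp add: k_def add.commute)
    obtain R where R: "locating_set (cycle_graph n) R" "0 \<in> R" "card R \<le> k"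
      using ex_optimal_locating_set_cycle_graph[OF n] unfolding k_def by blast
    obtain S where S: "connected_resolving_set ?W S" "v \<in> S" "card S \<le> card R + 1"
      using ex_hub_connected_resolving_set[OF assms(1) R(1,2) assms(2)] by blast
    then have S_le: "card S \<le> k + 1" using R(3) by linarith
    have low: "k + 1 \<le> card T" if T: "connected_resolving_set ?W T" for T
    proof (cases "hub \<in> T")
      case True
      then show ?thesis using hub_bound[OF T] by (simp add: k_def)
    next
      case False
      then show ?thesis using rim_bound(2)[OF T] n by (simp add: k_def)
    qed
    have "cdim ?W = k + 1" by (rule cdim_eqI[OF S(1) S_le low])
    then show "int (cdim ?W) = \<lfloor>(2 * real n + 2) / 5\<rfloor> + 1" unfolding floor by simp
    have "cdim_at ?W v = k + 1" by (rule cdim_at_eqI[OF S(1,2) S_le low])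
    then show "int (cdim_at ?W v) = \<lfloor>(2 * real n + 2) / 5\<rfloor> + 1" unfolding floor by simp
  }
qed

end
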